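(* Let $N\ge 2$ be an integer and let $pds_{ND}(n)$ be the number of (non-oriented) $N$-dimensional partially directed snakes of length $n$. Then, as formal power series, $$\sum_{n\ge 0} pds_{ND}(n)\,q^n=\frac{(N-1)^{2}q^{5}+(N-1)(N-2)q^{4}-(N-1)(N-3)q^{3}+(N-1)q^{2}-Nq+1}{(1-q)\left(1-Nq-(N-1)^{2}q^{3}\right)}.$$
   Context: Cells are the unit $N$-cubes of the lattice $\mathbb{Z}^N$ (coordinate axes $x_1,\dots,x_N$); two cells are adjacent if they share an $(N-1)$-dimensional facet, i.e. their positions in $\mathbb{Z}^N$ differ by $\pm$ a unit coordinate vector. An $ND$ snake of length $n$ is a connected set of $n$ cells, considered up to translation, whose adjacency graph has no cycle and in which every cell has degree at most two (so the adjacency graph is a path). Snakes are non-oriented, i.e. counted as sets of cells up to translation (no rotations or reflections). An $ND$ snake is an $ND$ partially directed snake ($ND$ PDS) if its cells can be listed from one end of the path to the other so that each step is in one of the directions $x_1^+,x_1^-,x_2^+,x_3^+,\dots,x_N^+$ (negative steps are allowed only along the $x_1$ axis). By convention the empty snake is the unique $ND$ PDS of length $0$. *)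

theory Defs
  imports
    "HOL-Library.Function_Algebras"
    "HOL-Computational_Algebra.Formal_Power_Series"
begin

text \<open>
  A cell is identified with its position in the lattice. Positions in dimension \<open>N\<close> are functions
  on all of \<open>nat\<close> that vanish outside the coordinate indices \<open>1, \<dots>, N\<close>, so that \<open>N\<close> can be an
  ordinary variable; sums, differences and negations of positions are pointwise.
\<close>

type_synonym cell = "nat \<Rightarrow> int"

definition cell_lattice :: "nat \<Rightarrow> cell set" where
  "cell_lattice N = {p. \<forall>i. i \<notin> {1..N} \<longrightarrow> p i = 0}"

definition unit_vec :: "nat \<Rightarrow> cell" where
  "unit_vec i = (\<lambda>j. if j = i then 1 else 0)"

definition adjacent :: "nat \<Rightarrow> cell \<Rightarrow> cell \<Rightarrow> bool" where
  "adjacent N p q \<longleftrightarrow> (\<exists>i\<in>{1..N}. q - p = unit_vec i \<or> q - p = - unit_vec i)"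

definition connected_cells :: "nat \<Rightarrow> cell set \<Rightarrow> bool" where
  "connected_cells N S \<longleftrightarrow>
     (\<forall>p\<in>S. \<forall>q\<in>S. (\<lambda>a b. a \<in> S \<and> b \<in> S \<and> adjacent N a b)\<^sup>*\<^sup>* p q)"

definition cell_cycle :: "nat \<Rightarrow> cell set \<Rightarrow> cell list \<Rightarrow> bool" where
  "cell_cycle N S c \<longleftrightarrow>
     length c \<ge> 3 \<and> distinct c \<and> set c \<subseteq> S \<and>
     successively (adjacent N) c \<and> adjacent N (last c) (hd c)"

definition cell_degree :: "nat \<Rightarrow> cell set \<Rightarrow> cell \<Rightarrow> nat" where
  "cell_degree N S p = card {q \<in> S. adjacent N p q}"

text \<open>
  The empty set qualifies as a snake (of length 0). Snakes are placed in the lattice here;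
  translates are identified only when counting.
\<close>

definition snake :: "nat \<Rightarrow> cell set \<Rightarrow> bool" where
  "snake N S \<longleftrightarrow>
     S \<subseteq> cell_lattice N \<and> finite S \<and> connected_cells N S \<and>
     (\<nexists>c. cell_cycle N S c) \<and> (\<forall>p\<in>S. cell_degree N S p \<le> 2)"

definition pd_directions :: "nat \<Rightarrow> cell set" where
  "pd_directions N = {unit_vec 1, - unit_vec 1} \<union> unit_vec ` {2..N}"

text \<open>
  Consecutive cells of the list below are adjacent and each cell of \<open>S\<close> is listed exactly once, so
  for a snake \<open>S\<close> the list runs through the adjacency path from one end to the other.
\<close>

definition partially_directed_snake :: "nat \<Rightarrow> cell set \<Rightarrow> bool" where
  "partially_directed_snake N S \<longleftrightarrow>
     snake N S \<and>
     (\<exists>cs. distinct cs \<and> set cs = S \<and> successively (\<lambda>p q. q - p \<in> pd_directions N) cs)"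

definition pds_of_length :: "nat \<Rightarrow> nat \<Rightarrow> cell set set" where
  "pds_of_length N n = {S. partially_directed_snake N S \<and> card S = n}"

definition translation_rel :: "nat \<Rightarrow> (cell set \<times> cell set) set" where
  "translation_rel N =
     {(S, T). S \<subseteq> cell_lattice N \<and> T \<subseteq> cell_lattice N \<and> (\<exists>v\<in>cell_lattice N. T = (\<lambda>p. p + v) ` S)}"

definition pds :: "nat \<Rightarrow> nat \<Rightarrow> nat" where
  "pds N n = card (pds_of_length N n // translation_rel N)"

end

(*
  A list of steps traces an induced path iff no two steps at distance one or two have opposite
  directions along the x_1 axis. Indeed, a factor with zero or unit displacement contains at most
  one step off that axis, and under this condition all its x_1-steps then have a common sign, so it
  has length at most one. Only the two straight words along the x_1 axis trace the same snake, up
  to translation, so the number of snakes of length m + 1 is the number of such words of length m,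
  minus one if m > 0. Sorting words by their first two letters gives a linear recurrence.
*)
theory Submission
  imports Defs
begin

subsection \<open>Steps and their displacement\<close>

text \<open>Call a step off the x_1 axis a rise. Distance two is the right bound because rises are
  never undone: a good word in which two rises separate two cells cannot make these cells touch
  again, so opposite x_1-steps do harm only with at most one rise between them. Conversely both bans
  are forced: opposite neighbouring steps revisit a cell, and opposite steps at distance two close a
  4-cycle. The straight words are the only coincidence because reading a path backwards negates
  every step, and the negative of a rise is not an allowed direction. The recurrence comes from
  extending words at the front. A rise can be prepended to any word, in N - 1 ways; an x_1-step in
  two ways, or in one way if one of the first two letters lies on the axis. Eliminating the
  auxiliary counts gives g(m+3) = N g(m+2) + (N-1)^2 g(m), whence the factor 1 - Nq - (N-1)^2 q^3.
  The subtracted one accounts for the factor 1 - q.\<close>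

lemma sum_list_fun_apply: "sum_list w i = (\<Sum>d\<leftarrow>w. d i)"
  for w :: "('a \<Rightarrow> 'b::comm_monoid_add) list"
  by (induction w) auto

lemma pd_directionsE:
  assumes "d \<in> pd_directions N"
  obtains "d = unit_vec 1" "d 1 = 1" | "d = - unit_vec 1" "d 1 = -1"
  | i where "i \<in> {2..N}" "d = unit_vec i" "d 1 = 0"
  using assms by (auto simp: pd_directions_def unit_vec_def)

lemma pd_directions_adjacent:
  assumes "q - p \<in> pd_directions N" "N \<ge> 2"
  shows "adjacent N p q"
  using assms by (force simp: pd_directions_def adjacent_def)

lemma adjacent_sym: "adjacent N p q \<longleftrightarrow> adjacent N q p"
proof -
  have "q - p = unit_vec i \<or> q - p = - unit_vec i \<longleftrightarrow> p - q = unit_vec i \<or> p - q = - unit_vec i" for i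
    by (metis minus_diff_eq minus_minus)
  then show ?thesis
    by (simp add: adjacent_def)
qed

lemma pd_directions_lattice: "d \<in> pd_directions N \<Longrightarrow> N \<ge> 2 \<Longrightarrow> d \<in> cell_lattice N"
  by (auto simp: pd_directions_def cell_lattice_def unit_vec_def)

lemma rise_pd_direction:
  assumes "d \<in> pd_directions N"
  shows "(\<Sum>i=2..N. d i) = (if d 1 = 0 then 1 else 0)"
  using assms by (cases rule: pd_directionsE) (auto simp: unit_vec_def sum_negf)

text \<open>Each step adds 0 or 1 to the sum of the coordinates 2, ..., N. The displacement alone
  therefore reveals the number of rises, even though the order of the steps is lost.\<close>

lemma rise_sum_list:
  assumes "set w \<subseteq> pd_directions N"
  shows "(\<Sum>i=2..N. sum_list w i) = int (length (filter (\<lambda>d. d 1 = 0) w))"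
  using assms
proof (induction w)
  case (Cons d w)
  then show ?case
    using rise_pd_direction[of d N] by (auto simp: sum.distrib)
qed auto

subsection \<open>Words tracing induced paths\<close>

text \<open>Entries at index \<open>1\<close> are the \<open>x\<^sub>1\<close>-components, so the product is \<open>-1\<close> for opposite steps along that axis.\<close>

definition good :: "cell list \<Rightarrow> bool" where
  "good w \<longleftrightarrow> (\<forall>j<length w. \<forall>i<j. j \<le> i + 2 \<longrightarrow> (w ! i) 1 * (w ! j) 1 \<noteq> -1)"

lemma good_Nil [simp]: "good []"
  by (simp add: good_def)

text \<open>Only letters at distance at most two constrain each other, so a new head is tested
  against the first two letters alone. The induction on signs and the whole count rest on
  this.\<close>

lemma good_Cons:
  "good (d # w) \<longleftrightarrow> good w \<and> (\<forall>j<length w. j < 2 \<longrightarrow> d 1 * (w ! j) 1 \<noteq> -1)"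
proof
  assume L: "good (d # w)"
  have "good w"
    unfolding good_def
  proof (intro allI impI)
    fix j i assume "j < length w" "i < j" "j \<le> i + 2"
    then show "(w ! i) 1 * (w ! j) 1 \<noteq> -1"
      using L[unfolded good_def, rule_format, of "Suc j" "Suc i"] by simp
  qed
  moreover have "d 1 * (w ! j) 1 \<noteq> -1" if "j < length w" "j < 2" for j
    using L[unfolded good_def, rule_format, of "Suc j" 0] that by simp
  ultimately show "good w \<and> (\<forall>j<length w. j < 2 \<longrightarrow> d 1 * (w ! j) 1 \<noteq> -1)"
    by blast
next
  assume R: "good w \<and> (\<forall>j<length w. j < 2 \<longrightarrow> d 1 * (w ! j) 1 \<noteq> -1)"
  show "good (d # w)"
    unfolding good_def
  proof (intro allI impI)
    fix j i assume *: "j < length (d # w)" "i < j" "j \<le> i + 2"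
    then obtain j' where j: "j = Suc j'" by (cases j) auto
    show "((d # w) ! i) 1 * ((d # w) ! j) 1 \<noteq> -1"
    proof (cases i)
      case 0 then show ?thesis using R * j by auto
    next
      case (Suc i') then show ?thesis using R * j by (auto simp: good_def)
    qed
  qed
qed

lemma good_take: "good w \<Longrightarrow> good (take n w)"
  by (simp add: good_def)

lemma good_drop: "good w \<Longrightarrow> good (drop n w)"
  unfolding good_def
proof (intro allI impI)
  fix j i
  assume "\<forall>j<length w. \<forall>i<j. j \<le> i + 2 \<longrightarrow> (w ! i) 1 * (w ! j) 1 \<noteq> -1"
    and "j < length (drop n w)" "i < j" "j \<le> i + 2"
  then show "(drop n w ! i) 1 * (drop n w ! j) 1 \<noteq> -1"
    by (auto dest!: spec[of _ "n + j"] spec[of _ "n + i"])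
qed

text \<open>With at most one rise present, two successive x_1-steps are at distance at most two, so
  \<open>good\<close> makes them agree; the agreement then propagates along the word.\<close>

lemma good_common_sign:
  assumes "good w" "set w \<subseteq> pd_directions N" "length (filter (\<lambda>d. d 1 = 0) w) \<le> 1"
  shows "\<exists>s\<in>{1,-1}. \<forall>d\<in>set w. d 1 = 0 \<or> d 1 = s"
  using assms
proof (induction w)
  case (Cons d w)
  then obtain s where s: "s \<in> {1,-1}" "\<forall>d\<in>set w. d 1 = 0 \<or> d 1 = s"
    by (auto simp: good_Cons split: if_splits)
  have d: "d 1 = 0 \<or> d 1 = 1 \<or> d 1 = -1"
    using Cons.prems by (auto elim!: pd_directionsE)
  have step: "\<forall>j<length w. j < 2 \<longrightarrow> d 1 * (w ! j) 1 \<noteq> -1"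
    using Cons.prems by (auto simp: good_Cons)
  show ?case
  proof (cases "d 1 = 0 \<or> (\<forall>x\<in>set w. x 1 = 0)")
    case True
    then show ?thesis using s d by auto
  next
    case False
    \<comment> \<open>One of the first two letters of \<open>w\<close> is an x_1-step, since at most
      one of them can be a rise; that letter passes the sign \<open>s\<close> on to
      \<open>d\<close>.\<close>
    have "\<exists>j<length w. j < 2 \<and> (w ! j) 1 \<noteq> 0"
    proof (cases w)
      case (Cons x v)
      show ?thesis
      proof (cases v)
        case Nil
        then show ?thesis using False Cons by auto
      next
        case (Cons y t)
        have "x 1 \<noteq> 0 \<or> y 1 \<noteq> 0"
          using Cons.prems(3) \<open>w = x # v\<close> \<open>v = y # t\<close> \<open>length (filter (\<lambda>d. d 1 = 0) (d # w)) \<le> 1\<close>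
          by (auto split: if_splits)
        then show ?thesis
          using \<open>w = x # v\<close> \<open>v = y # t\<close> by (auto intro: exI[of _ 0] exI[of _ 1])
      qed
    qed (use False in auto)
    then obtain j where j: "j < length w" "j < 2" "(w ! j) 1 \<noteq> 0" by blast
    then have "(w ! j) 1 = s" using s by auto
    then have "d 1 = s" using step j d s False by auto
    then show ?thesis using s by auto
  qed
qed auto

text \<open>Nothing cancels along x_1 once the sign is common. Together with the rise count, the
  displacement now determines the length.\<close>

lemma good_abs_sum_list:
  assumes "good w" "set w \<subseteq> pd_directions N" "length (filter (\<lambda>d. d 1 = 0) w) \<le> 1"
  shows "\<bar>sum_list w 1\<bar> = int (length w) - int (length (filter (\<lambda>d. d 1 = 0) w))"
proof -
  obtain s where s: "s \<in> {1,-1}" "\<forall>d\<in>set w. d 1 = 0 \<or> d 1 = s"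
    using good_common_sign[OF assms] by blast
  have "sum_list w 1 = s * (int (length w) - int (length (filter (\<lambda>d. d 1 = 0) w)))"
    using s(2) by (induction w) (use s(1) in \<open>auto simp: algebra_simps\<close>)
  moreover have "length (filter (\<lambda>d. d 1 = 0) w) \<le> length w"
    by simp
  ultimately show ?thesis
    using s(1) by auto
qed

lemma good_sum_list_nonzero:
  assumes "good w" "set w \<subseteq> pd_directions N" "w \<noteq> []"
  shows "sum_list w \<noteq> 0"
proof
  assume "sum_list w = 0"
  then show False
    using rise_sum_list[OF assms(2)] good_abs_sum_list[OF assms(1,2)] assms(3) by simp
qed

text \<open>The length is the absolute x_1-displacement plus the number of rises, and for a unit
  displacement this total is at most 1.\<close>

lemma good_sum_list_not_unit:
  assumes "good w" "set w \<subseteq> pd_directions N" "length w \<ge> 2" "i \<in> {1..N}"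
    and unit: "sum_list w = unit_vec i \<or> sum_list w = - unit_vec i"
  shows False
proof -
  let ?z = "length (filter (\<lambda>d. d 1 = 0) w)"
  have z: "int ?z = (\<Sum>j=2..N. sum_list w j)"
    using rise_sum_list[OF assms(2)] by simp
  show False
  proof (cases "i = 1")
    case True
    then have "(\<Sum>j=2..N. sum_list w j) = 0"
      using unit by (intro sum.neutral) (auto simp: unit_vec_def)
    moreover have "\<bar>sum_list w 1\<bar> = 1"
      using unit True by (auto simp: unit_vec_def)
    ultimately show False
      using z good_abs_sum_list[OF assms(1,2)] assms(3) by simp
  next
    case False
    then have "i \<in> {2..N}" using assms(4) by auto
    then have "(\<Sum>j=2..N. unit_vec i j) = 1" by (simp add: unit_vec_def)
    then have "?z \<le> 1"
      using z unit by (auto simp: sum_negf)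
    moreover have "sum_list w 1 = 0"
      using unit False by (auto simp: unit_vec_def)
    ultimately show False
      using good_abs_sum_list[OF assms(1,2)] assms(3) by simp
  qed
qed

section \<open>Cells along a word and their adjacencies\<close>

definition pos :: "cell \<Rightarrow> cell list \<Rightarrow> nat \<Rightarrow> cell" where
  "pos p w i = p + sum_list (take i w)"

lemma pos_0 [simp]: "pos p w 0 = p"
  by (simp add: pos_def)

lemma pos_Suc: "i < length w \<Longrightarrow> pos p w (Suc i) = pos p w i + w ! i"
  by (simp add: pos_def take_Suc_conv_app_nth add.assoc)

text \<open>Reduces the comparison of two cells to the displacement of the factor between them,
  which is again good by \<open>good_take\<close> and \<open>good_drop\<close>.\<close>

lemma pos_diff:
  assumes "i \<le> j"
  shows "pos p w j - pos p w i = sum_list (take (j - i) (drop i w))"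
proof -
  have "take j w = take i w @ take (j - i) (drop i w)"
    using assms by (metis le_add_diff_inverse take_add)
  then show ?thesis by (simp add: pos_def)
qed

lemma pos_lattice:
  assumes "p \<in> cell_lattice N" "set w \<subseteq> pd_directions N" "N \<ge> 2"
  shows "pos p w i \<in> cell_lattice N"
proof -
  have "sum_list v \<in> cell_lattice N" if "set v \<subseteq> cell_lattice N" for v
    using that by (induction v) (auto simp: cell_lattice_def)
  moreover have "set (take i w) \<subseteq> cell_lattice N"
    using assms(2,3) by (auto dest!: in_set_takeD intro: pd_directions_lattice)
  ultimately have "sum_list (take i w) \<in> cell_lattice N"
    by blast
  then show ?thesis
    using assms(1) unfolding pos_def cell_lattice_def by simp
qed

lemma pos_inj_on:
  assumes "good w" "set w \<subseteq> pd_directions N"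
  shows "inj_on (pos p w) {..length w}"
proof (rule linorder_inj_onI)
  fix i j assume ij: "i < j" "i \<in> {..length w}" "j \<in> {..length w}"
  let ?v = "take (j - i) (drop i w)"
  have "set ?v \<subseteq> pd_directions N"
    using assms(2) by (meson order.trans set_drop_subset set_take_subset)
  moreover have "?v \<noteq> []" using ij by simp
  ultimately have "sum_list ?v \<noteq> 0"
    using assms(1) by (intro good_sum_list_nonzero good_take good_drop)
  then show "pos p w i \<noteq> pos p w j"
    using pos_diff[of i j p w] ij by auto
qed auto

lemma adjacent_pos_Suc:
  assumes "good w" "set w \<subseteq> pd_directions N" "i < j" "j \<le> length w"
    and "adjacent N (pos p w i) (pos p w j)"
  shows "j = Suc i"
proof (rule ccontr)
  assume "j \<noteq> Suc i"
  let ?v = "take (j - i) (drop i w)"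
  have "set ?v \<subseteq> pd_directions N"
    using assms(2) by (meson order.trans set_drop_subset set_take_subset)
  moreover have "length ?v \<ge> 2" using assms \<open>j \<noteq> Suc i\<close> by simp
  ultimately show False
    using assms good_sum_list_not_unit[of ?v N] pos_diff[of i j p w] good_take good_drop
    unfolding adjacent_def by (metis less_imp_le_nat)
qed

text \<open>The exact sense in which good words trace induced paths. Acyclicity, the degree bound
  and the comparison of two traces of one snake are all read off from it.\<close>

lemma adjacent_pos_iff:
  assumes "good w" "set w \<subseteq> pd_directions N" "N \<ge> 2" "i \<le> length w" "j \<le> length w"
  shows "adjacent N (pos p w i) (pos p w j) \<longleftrightarrow> j = Suc i \<or> i = Suc j"
proof -
  have *: "adjacent N (pos p w i) (pos p w (Suc i))" if "Suc i \<le> length w" for i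
    using that assms(2,3) by (intro pd_directions_adjacent) (auto simp: pos_Suc)
  have "\<not> adjacent N (pos p w i) (pos p w i)"
    by (auto simp: adjacent_def fun_eq_iff unit_vec_def)
  then show ?thesis
    using adjacent_pos_Suc[OF assms(1,2), of i j p] adjacent_pos_Suc[OF assms(1,2), of j i p]
      assms(4,5) *[of i] *[of j] adjacent_sym
    by (metis linorder_neqE_nat)
qed

subsection \<open>Partially directed snakes as words\<close>

lemma connected_pos:
  assumes "set w \<subseteq> pd_directions N" "N \<ge> 2"
  shows "connected_cells N (pos p w ` {..length w})"
proof -
  let ?S = "pos p w ` {..length w}"
  define r where "r = (\<lambda>a b. a \<in> ?S \<and> b \<in> ?S \<and> adjacent N a b)"
  have step: "r (pos p w i) (pos p w (Suc i))" "r (pos p w (Suc i)) (pos p w i)"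
    if "Suc i \<le> length w" for i
  proof -
    have "adjacent N (pos p w i) (pos p w (Suc i))"
      using that assms by (intro pd_directions_adjacent) (auto simp: pos_Suc)
    then show "r (pos p w i) (pos p w (Suc i))" "r (pos p w (Suc i)) (pos p w i)"
      using that adjacent_sym by (auto simp: r_def)
  qed
  have "r\<^sup>*\<^sup>* (pos p w 0) (pos p w i) \<and> r\<^sup>*\<^sup>* (pos p w i) (pos p w 0)" if "i \<le> length w" for i
    using that
  proof (induction i)
    case (Suc i)
    then have IH: "r\<^sup>*\<^sup>* (pos p w 0) (pos p w i)" "r\<^sup>*\<^sup>* (pos p w i) (pos p w 0)"
      by simp_all
    show ?case
      using rtranclp.rtrancl_into_rtrancl[of r, OF IH(1) step(1)[OF Suc.prems]]
        converse_rtranclp_into_rtranclp[of r, OF step(2)[OF Suc.prems] IH(2)] by blast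
  qed simp
  then have "r\<^sup>*\<^sup>* a b" if "a \<in> ?S" "b \<in> ?S" for a b
    using that by (auto intro: rtranclp_trans)
  then show ?thesis
    unfolding connected_cells_def r_def by blast
qed

text \<open>The closing edge of a \<open>cell_cycle\<close> joins the two ends of the list, so these
  are separate cases; length at least 3 keeps the two neighbours distinct.\<close>

lemma cycle_two_neighbours:
  assumes "cell_cycle N S c" "t < length c"
  obtains a b where "a < length c" "b < length c" "a \<noteq> b" "adjacent N (c ! t) (c ! a)" "adjacent N (c ! t) (c ! b)"
proof -
  have c: "length c \<ge> 3" "adjacent N (c ! (length c - 1)) (c ! 0)"
    using assms by (auto simp: cell_cycle_def last_conv_nth hd_conv_nth
      simp flip: length_greater_0_conv)
  have step: "adjacent N (c ! i) (c ! Suc i)" if "Suc i < length c" for i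
    using assms that by (auto simp: cell_cycle_def successively_conv_nth)
  consider "t = 0" | "t = length c - 1" "t \<noteq> 0" | "0 < t" "Suc t < length c"
    using assms by linarith
  then show ?thesis
  proof cases
    case 1
    then show ?thesis
      using c step[of 0] adjacent_sym by (intro that[of 1 "length c - 1"]) auto
  next
    case 2
    then show ?thesis
      using c step[of "length c - 2"] adjacent_sym
      by (intro that[of 0 "length c - 2"]) (auto simp: Suc_diff_Suc numeral_2_eq_2)
  next
    case 3
    then show ?thesis
      using c step[of t] step[of "t - 1"] adjacent_sym
      by (intro that[of "t - 1" "Suc t"]) auto
  qed
qed

lemma acyclic_pos:
  assumes "good w" "set w \<subseteq> pd_directions N" "N \<ge> 2"
  shows "\<not> cell_cycle N (pos p w ` {..length w}) c"
proof
  assume c: "cell_cycle N (pos p w ` {..length w}) c"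
  then have "\<forall>t<length c. \<exists>i\<le>length w. c ! t = pos p w i"
    by (auto simp: cell_cycle_def dest!: nth_mem)
  then obtain f where f: "\<And>t. t < length c \<Longrightarrow> f t \<le> length w \<and> c ! t = pos p w (f t)"
    by metis
  \<comment> \<open>Both neighbours of the cell furthest along the path would have to be its predecessor.\<close>
  have "finite (f ` {..<length c})" "f ` {..<length c} \<noteq> {}"
    using c unfolding cell_cycle_def by (simp, force)
  from Max_in[OF this] obtain t where t: "t < length c" "f t = Max (f ` {..<length c})"
    by auto
  have max: "f a \<le> f t" if "a < length c" for a
    unfolding t(2) using that by (intro Max_ge) auto
  obtain a b where ab: "a < length c" "b < length c" "a \<noteq> b"
    "adjacent N (c ! t) (c ! a)" "adjacent N (c ! t) (c ! b)"
    using cycle_two_neighbours[OF c t(1)] .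
  have "f t = Suc (f x)" if "x < length c" "adjacent N (c ! t) (c ! x)" for x
    using that f[OF t(1)] f[of x] max[of x] adjacent_pos_iff[OF assms, of "f t" "f x" p] by auto
  then have "c ! a = c ! b"
    using f[of a] f[of b] ab by (metis Suc_inject)
  then show False
    using c ab by (simp add: cell_cycle_def nth_eq_iff_index_eq)
qed

lemma partially_directed_snake_pos:
  assumes "good w" "set w \<subseteq> pd_directions N" "N \<ge> 2" "p \<in> cell_lattice N"
  shows "partially_directed_snake N (pos p w ` {..length w})"
  unfolding partially_directed_snake_def snake_def
proof (intro conjI ballI)
  let ?S = "pos p w ` {..length w}"
  let ?cs = "map (pos p w) [0..<Suc (length w)]"
  show "?S \<subseteq> cell_lattice N"
    using pos_lattice assms by auto
  show "connected_cells N ?S"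
    using connected_pos assms by blast
  show "\<nexists>c. cell_cycle N ?S c"
    using acyclic_pos assms by blast
  show "cell_degree N ?S x \<le> 2" if "x \<in> ?S" for x
  proof -
    obtain i where i: "i \<le> length w" "x = pos p w i"
      using \<open>x \<in> ?S\<close> by auto
    \<comment> \<open>At either end of the path one of the two listed cells is \<open>x\<close>
      itself, as \<open>i - 1\<close> truncates at 0 and \<open>take\<close> stops at the end of
      \<open>w\<close>. This is harmless for an upper bound.\<close>
    have "{q \<in> ?S. adjacent N x q} \<subseteq> {pos p w (i - 1), pos p w (Suc i)}"
      using adjacent_pos_iff[OF assms(1-3), of i _ p] i by auto
    then have "cell_degree N ?S x \<le> card {pos p w (i - 1), pos p w (Suc i)}"
      unfolding cell_degree_def by (intro card_mono) auto
    also have "\<dots> \<le> 2"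
      by (simp add: card_insert_if)
    finally show ?thesis .
  qed
  have "{0..<Suc (length w)} = {..length w}" by auto
  then have "distinct ?cs" "set ?cs = ?S"
    using pos_inj_on[OF assms(1,2), of p] by (auto simp: distinct_map simp del: upt_Suc)
  moreover have "successively (\<lambda>p q. q - p \<in> pd_directions N) ?cs"
    using assms(2) by (auto simp: successively_conv_nth pos_Suc nth_append simp del: upt_Suc)
  ultimately show "\<exists>cs. distinct cs \<and> set cs = ?S \<and> successively (\<lambda>p q. q - p \<in> pd_directions N) cs"
    by blast
qed simp

lemma card_pos:
  assumes "good w" "set w \<subseteq> pd_directions N"
  shows "card (pos p w ` {..length w}) = Suc (length w)"
  using card_image[OF pos_inj_on[OF assms]] by simp

text \<open>The word consists of the differences of consecutive cells. It is good because opposite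
  steps at distance one would repeat a cell of the distinct list, and opposite steps at distance two
  would create a cycle.\<close>

lemma partially_directed_snakeE:
  assumes "partially_directed_snake N S" "S \<noteq> {}" "N \<ge> 2"
  obtains p w where "good w" "set w \<subseteq> pd_directions N" "p \<in> cell_lattice N"
    "S = pos p w ` {..length w}"
proof -
  obtain cs where cs: "distinct cs" "set cs = S" "successively (\<lambda>p q. q - p \<in> pd_directions N) cs"
    using assms unfolding partially_directed_snake_def by blast
  define w where "w = map (\<lambda>i. cs ! Suc i - cs ! i) [0..<length cs - 1]"
  have len: "length cs = Suc (length w)"
    using cs(2) assms(2) by (cases cs) (auto simp: w_def)
  have w_nth: "w ! i = cs ! Suc i - cs ! i" if "i < length w" for i
    using that by (simp add: w_def)
  have D: "w ! i \<in> pd_directions N" if "i < length w" for i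
    using cs(3) that len w_nth by (auto simp: successively_conv_nth)
  have wD: "set w \<subseteq> pd_directions N"
    using D by (auto simp: in_set_conv_nth)
  have adj: "adjacent N (cs ! i) (cs ! Suc i)" if "i < length w" for i
    using D[OF that] w_nth[OF that] assms(3) by (intro pd_directions_adjacent) auto
  have pos: "pos (cs ! 0) w i = cs ! i" if "i \<le> length w" for i
    using that by (induction i) (auto simp: pos_Suc w_nth)
  have opp: "w ! j = - (w ! i)" if "(w ! i) 1 * (w ! j) 1 = -1" "i < length w" "j < length w" for i j
    using D[OF that(2)] D[OF that(3)] that(1)
    by (elim pd_directionsE) auto
  have one: "(w ! i) 1 * (w ! Suc i) 1 \<noteq> -1" if "Suc i < length w" for i
  proof
    assume "(w ! i) 1 * (w ! Suc i) 1 = -1"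
    then have "cs ! Suc (Suc i) = cs ! i"
      using opp[of i "Suc i"] that w_nth[of i] w_nth[of "Suc i"] by (simp add: algebra_simps)
    then show False
      using cs(1) that len by (simp add: nth_eq_iff_index_eq)
  qed
  have two: "(w ! i) 1 * (w ! Suc (Suc i)) 1 \<noteq> -1" if i: "Suc (Suc i) < length w" for i
  proof
    assume *: "(w ! i) 1 * (w ! Suc (Suc i)) 1 = -1"
    \<comment> \<open>The outer two of the three steps cancel, so the last of these four cells
      differs from the first by the middle step, which closes a 4-cycle.\<close>
    let ?c = "[cs ! i, cs ! Suc i, cs ! Suc (Suc i), cs ! Suc (Suc (Suc i))]"
    have "w ! Suc (Suc i) = - (w ! i)"
      using opp * i by simp
    then have "cs ! Suc (Suc (Suc i)) - cs ! i = w ! Suc i"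
    proof -
      have "cs ! Suc (Suc (Suc i)) - cs ! i = w ! Suc (Suc i) + w ! Suc i + w ! i"
        using w_nth[of i] w_nth[of "Suc i"] w_nth[of "Suc (Suc i)"] i by simp
      then show ?thesis
        unfolding \<open>w ! Suc (Suc i) = - (w ! i)\<close> by simp
    qed
    then have "adjacent N (cs ! Suc (Suc (Suc i))) (cs ! i)"
      using D[of "Suc i"] i pd_directions_adjacent[OF _ assms(3)] adjacent_sym
      by (metis Suc_lessD)
    then have "cell_cycle N S ?c"
      using adj i cs(1) len unfolding cell_cycle_def cs(2)[symmetric]
      by (auto simp: nth_eq_iff_index_eq)
    then show False
      using assms(1) unfolding partially_directed_snake_def snake_def by blast
  qed
  have "good w"
    unfolding good_def
  proof (intro allI impI)
    fix j i assume "j < length w" "i < j" "j \<le> i + 2"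
    then consider "j = Suc i" | "j = Suc (Suc i)" by linarith
    then show "(w ! i) 1 * (w ! j) 1 \<noteq> -1"
      using one two \<open>j < length w\<close> by cases auto
  qed
  moreover have "cs ! 0 \<in> cell_lattice N"
    using assms(1) cs(2) len unfolding partially_directed_snake_def snake_def by auto
  moreover have "S = pos (cs ! 0) w ` {..length w}"
  proof -
    have "S = (!) cs ` {..length w}"
      using cs(2) len by (auto simp: in_set_conv_nth less_Suc_eq_le)
    then show ?thesis using pos by auto
  qed
  ultimately show ?thesis
    using that wD by blast
qed

subsection \<open>Orientation and translation\<close>

text \<open>A turn would bring the walk back to its value two steps earlier, against injectivity. It
  is applied to the index map between two listings of the same snake; the descending case is stated
  additively to avoid truncated subtraction.\<close>

lemma inj_unit_walk:
  fixes f :: "nat \<Rightarrow> nat"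
  assumes "inj_on f {..m}" "\<And>k. k < m \<Longrightarrow> f (Suc k) = Suc (f k) \<or> f k = Suc (f (Suc k))"
  shows "(\<forall>k\<le>m. f k = f 0 + k) \<or> (\<forall>k\<le>m. f k + k = f 0)"
  using assms
proof (induction m)
  case (Suc m)
  have IH: "(\<forall>k\<le>m. f k = f 0 + k) \<or> (\<forall>k\<le>m. f k + k = f 0)"
    using Suc.prems by (intro Suc.IH) (auto intro: inj_on_subset)
  have step: "f (Suc m) = Suc (f m) \<or> f m = Suc (f (Suc m))"
    using Suc.prems(2)[of m] by simp
  show ?case
  proof (cases m)
    case 0
    then show ?thesis using step by (auto simp: le_Suc_eq)
  next
    case (Suc l)
    have "f (Suc m) \<noteq> f l"
      using Suc.prems(1) Suc by (auto dest!: inj_onD[where x = "Suc m" and y = l])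
    then show ?thesis
      using IH
    proof (elim disjE)
      assume *: "\<forall>k\<le>m. f k = f 0 + k"
      have "f (Suc m) = f 0 + Suc m"
        using *[rule_format, of m] *[rule_format, of l] step \<open>f (Suc m) \<noteq> f l\<close> Suc by linarith
      then show ?thesis using * by (metis le_Suc_eq)
    next
      assume *: "\<forall>k\<le>m. f k + k = f 0"
      have "f (Suc m) + Suc m = f 0"
        using *[rule_format, of m] *[rule_format, of l] step \<open>f (Suc m) \<noteq> f l\<close> Suc by linarith
      then show ?thesis using * by (metis le_Suc_eq)
    qed
  qed
qed simp

text \<open>The map \<open>f\<close> from indices along \<open>w'\<close> to indices along
  \<open>w\<close> preserves adjacency, so it is the identity or the reversal. A reversal negates
  every step; this rules out rises, and \<open>good\<close> then makes all x_1-steps equal.\<close>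

lemma pos_image_eqD:
  assumes "good w" "set w \<subseteq> pd_directions N" "length w = m"
    and "good w'" "set w' \<subseteq> pd_directions N" "length w' = m"
    and N: "N \<ge> 2" and eq: "pos p w ` {..m} = pos p' w' ` {..m}"
  shows "w = w' \<or> (\<exists>d\<in>{unit_vec 1, - unit_vec 1}. w = replicate m d \<and> w' = replicate m (- d))"
proof -
  have "\<forall>k\<le>m. \<exists>i\<le>m. pos p' w' k = pos p w i"
    using eq by (metis (no_types, lifting) atMost_iff image_iff)
  then obtain f where f: "\<And>k. k \<le> m \<Longrightarrow> f k \<le> m \<and> pos p' w' k = pos p w (f k)"
    by metis
  have "inj_on f {..m}"
  proof (rule inj_onI)
    fix x y assume "x \<in> {..m}" "y \<in> {..m}" "f x = f y"
    then show "x = y"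
      using f[of x] f[of y] inj_onD[OF pos_inj_on[OF assms(4,5), of p'], of x y] assms(6) by simp
  qed
  moreover have "f (Suc k) = Suc (f k) \<or> f k = Suc (f (Suc k))" if "k < m" for k
    using adjacent_pos_iff[OF assms(1,2) N, of "f k" "f (Suc k)" p]
      adjacent_pos_iff[OF assms(4,5) N, of k "Suc k" p'] f[of k] f[of "Suc k"] that assms(3,6)
    by auto
  ultimately consider "\<forall>k\<le>m. f k = f 0 + k" | "\<forall>k\<le>m. f k + k = f 0"
    using inj_unit_walk by blast
  then show ?thesis
  proof cases
    case 1
    \<comment> \<open>The bound \<open>f m \<le> m\<close> forces \<open>f 0 = 0\<close>; in the
      descending case \<open>f 0 \<le> m\<close> likewise forces \<open>f 0 = m\<close>.\<close>
    then have "f k = k" if "k \<le> m" for k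
      using 1[rule_format, of m] 1[rule_format, of k] f[of m] that by linarith
    then have "pos p' w' k = pos p w k" if "k \<le> m" for k
      using f that by auto
    then have "w' ! k = w ! k" if "k < m" for k
      using that pos_Suc[of k w p] pos_Suc[of k w' p'] assms(3,6)
      by (metis Suc_leI add_left_cancel less_imp_le_nat)
    then show ?thesis
      using assms(3,6) by (auto intro: nth_equalityI)
  next
    case 2
    then have "f k = m - k" if "k \<le> m" for k
      using f[of 0] that by (metis add_diff_cancel_right' diff_zero le_add2 le_antisym le_refl)
    then have pos: "pos p' w' k = pos p w (m - k)" if "k \<le> m" for k
      using f that by auto
    have opp: "w' ! k = - (w ! (m - Suc k))" if "k < m" for k
    proof -
      have "pos p w (m - Suc k) = pos p w (m - Suc k) + w ! (m - Suc k) + w' ! k"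
        using that pos_Suc[of "m - Suc k" w p] pos_Suc[of k w' p'] pos[of k] pos[of "Suc k"] assms(3,6)
        by (simp add: Suc_diff_Suc)
      then have "w ! (m - Suc k) + w' ! k = 0"
        by (simp only: add.assoc add_cancel_right_right)
      then show ?thesis
        by (simp only: add_eq_0_iff)
    qed
    have D: "w ! k \<in> pd_directions N" "w' ! k \<in> pd_directions N" if "k < m" for k
      using assms that by auto
    have horizontal: "(w ! k) 1 \<noteq> 0" if "k < m" for k
    proof
      assume "(w ! k) 1 = 0"
      have "w' ! (m - Suc k) = - (w ! k)" "m - Suc k < m"
        using opp[of "m - Suc k"] that by auto
      then have "- (w ! k) \<in> pd_directions N"
        using D by metis
      \<comment> \<open>A rise and its negative would both increase the sum of the coordinates 2,
        ..., N by one.\<close>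
      then have "(\<Sum>i=2..N. (- (w ! k)) i) = 1" "(\<Sum>i=2..N. (w ! k) i) = 1"
        using rise_pd_direction[of "- (w ! k)" N] rise_pd_direction[OF D(1)[OF that]]
          \<open>(w ! k) 1 = 0\<close> by simp_all
      then show False
        by (simp add: sum_negf)
    qed
    then have "filter (\<lambda>d. d 1 = 0) w = []"
      using assms(3) by (auto simp: filter_empty_conv in_set_conv_nth)
    then obtain s where s: "s \<in> {1,-1}" "\<forall>d\<in>set w. d 1 = 0 \<or> d 1 = s"
      using good_common_sign[OF assms(1,2)] by auto
    define d where "d = (if s = 1 then unit_vec 1 else - unit_vec 1)"
    have "w ! k = d" if "k < m" for k
    proof -
      have "(w ! k) 1 = s" using s(2) horizontal[OF that] that assms(3) by auto
      then show ?thesis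
        using D(1)[OF that] s(1) by (elim pd_directionsE) (auto simp: d_def)
    qed
    then have "w = replicate m d" "w' = replicate m (- d)"
      using assms(3,6) opp by (auto intro!: nth_equalityI)
    then show ?thesis
      by (auto simp: d_def)
  qed
qed

section \<open>Snakes up to translation\<close>

lemma equiv_translation_rel: "equiv (Pow (cell_lattice N)) (translation_rel N)"
proof (rule equivI)
  show "refl_on (Pow (cell_lattice N)) (translation_rel N)"
  proof (rule refl_onI)
    fix S assume "S \<in> Pow (cell_lattice N)"
    moreover have "0 \<in> cell_lattice N" "S = (\<lambda>p. p + 0) ` S"
      by (simp_all add: cell_lattice_def)
    ultimately show "(S, S) \<in> translation_rel N"
      unfolding translation_rel_def by blast
  qed
  show "translation_rel N \<subseteq> Pow (cell_lattice N) \<times> Pow (cell_lattice N)"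
    by (auto simp: translation_rel_def)
  show "sym (translation_rel N)"
  proof (rule symI)
    fix S T assume "(S, T) \<in> translation_rel N"
    then obtain v where "S \<subseteq> cell_lattice N" "T \<subseteq> cell_lattice N" "v \<in> cell_lattice N"
      "T = (\<lambda>p. p + v) ` S"
      by (auto simp: translation_rel_def)
    moreover from this have "- v \<in> cell_lattice N" "S = (\<lambda>p. p + - v) ` T"
      by (auto simp: cell_lattice_def image_image)
    ultimately show "(T, S) \<in> translation_rel N"
      unfolding translation_rel_def by blast
  qed
  show "trans (translation_rel N)"
  proof (rule transI)
    fix S T R assume "(S, T) \<in> translation_rel N" "(T, R) \<in> translation_rel N"
    then obtain u v where "S \<subseteq> cell_lattice N" "R \<subseteq> cell_lattice N" "u \<in> cell_lattice N"
      "v \<in> cell_lattice N" "R = (\<lambda>p. p + v) ` (\<lambda>p. p + u) ` S"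
      by (auto simp: translation_rel_def)
    moreover from this have "u + v \<in> cell_lattice N" "R = (\<lambda>p. p + (u + v)) ` S"
      by (auto simp: cell_lattice_def image_image add.assoc)
    ultimately show "(S, R) \<in> translation_rel N"
      unfolding translation_rel_def by blast
  qed
qed

definition good_words :: "nat \<Rightarrow> nat \<Rightarrow> cell list set" where
  "good_words N m = {w. set w \<subseteq> pd_directions N \<and> length w = m \<and> good w}"

definition snake_class :: "nat \<Rightarrow> cell list \<Rightarrow> cell set set" where
  "snake_class N w = translation_rel N `` {pos 0 w ` {..length w}}"

lemma pos_image_translate: "pos p w ` A = (\<lambda>x. x + p) ` pos 0 w ` A"
  by (simp add: pos_def image_image add.commute)

lemma zero_in_cell_lattice [simp]: "0 \<in> cell_lattice N"
  by (simp add: cell_lattice_def)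

lemma pos_image_lattice:
  assumes "set w \<subseteq> pd_directions N" "N \<ge> 2" "p \<in> cell_lattice N"
  shows "pos p w ` A \<in> Pow (cell_lattice N)"
  using pos_lattice assms by auto

text \<open>A translation only changes the starting cell, so equality of classes takes the form that
  \<open>pos_image_eqD\<close> expects.\<close>

lemma snake_class_eq_iff:
  assumes "set w \<subseteq> pd_directions N" "set w' \<subseteq> pd_directions N" "N \<ge> 2"
  shows "snake_class N w = snake_class N w' \<longleftrightarrow>
    (\<exists>v\<in>cell_lattice N. pos 0 w' ` {..length w'} = pos v w ` {..length w})"
proof -
  have *: "pos 0 w ` {..length w} \<in> Pow (cell_lattice N)"
    "pos 0 w' ` {..length w'} \<in> Pow (cell_lattice N)"
    using pos_image_lattice[OF assms(1,3) zero_in_cell_lattice]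
      pos_image_lattice[OF assms(2,3) zero_in_cell_lattice] by blast+
  show ?thesis
    unfolding snake_class_def eq_equiv_class_iff[OF equiv_translation_rel *]
    using * by (simp add: translation_rel_def pos_image_translate[symmetric])
qed

text \<open>A word of \<open>m\<close> steps visits \<open>Suc m\<close> cells, and every class
  contains a trace starting at the origin.\<close>

lemma quotient_pds_of_length:
  assumes "N \<ge> 2"
  shows "pds_of_length N (Suc m) // translation_rel N = snake_class N ` good_words N m"
proof (intro equalityI subsetI)
  fix X assume "X \<in> pds_of_length N (Suc m) // translation_rel N"
  then obtain S where S: "partially_directed_snake N S" "card S = Suc m" "X = translation_rel N `` {S}"
    by (auto simp: quotient_def pds_of_length_def)
  then have "S \<noteq> {}" by auto
  then obtain p w where w: "good w" "set w \<subseteq> pd_directions N" "p \<in> cell_lattice N"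
    "S = pos p w ` {..length w}"
    using partially_directed_snakeE[OF S(1) _ assms] by metis
  have "S = (\<lambda>x. x + p) ` pos 0 w ` {..length w}"
    unfolding w(4) by (rule pos_image_translate)
  moreover have "S \<subseteq> cell_lattice N" "pos 0 w ` {..length w} \<subseteq> cell_lattice N"
    using pos_image_lattice[OF w(2) assms w(3)] pos_image_lattice[OF w(2) assms zero_in_cell_lattice]
    unfolding w(4) by blast+
  ultimately have "(pos 0 w ` {..length w}, S) \<in> translation_rel N"
    using w(3) unfolding translation_rel_def by blast
  then have "X = snake_class N w"
    unfolding snake_class_def S(3) using equiv_class_eq[OF equiv_translation_rel] by metis
  moreover have "w \<in> good_words N m"
    using card_pos[OF w(1,2)] S(2) w by (auto simp: good_words_def)
  ultimately show "X \<in> snake_class N ` good_words N m" by blast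
next
  fix X assume "X \<in> snake_class N ` good_words N m"
  then obtain w where w: "w \<in> good_words N m" "X = snake_class N w" by blast
  then have "pos 0 w ` {..length w} \<in> pds_of_length N (Suc m)"
    using partially_directed_snake_pos[of w N 0] card_pos[of w N 0] assms
    by (auto simp: pds_of_length_def good_words_def)
  then show "X \<in> pds_of_length N (Suc m) // translation_rel N"
    unfolding w(2) snake_class_def by (rule quotientI)
qed

lemma finite_good_words: "finite (good_words N m)"
proof -
  have "finite (pd_directions N)" by (simp add: pd_directions_def)
  then show ?thesis
    using finite_lists_length_eq[of "pd_directions N" m] by (auto simp: good_words_def elim: finite_subset[rotated])
qed

lemma replicate_good_words: "d \<in> {unit_vec 1, - unit_vec 1} \<Longrightarrow> replicate m d \<in> good_words N m"
  by (auto simp: good_words_def good_def pd_directions_def unit_vec_def)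

lemma snake_class_replicate:
  assumes "N \<ge> 2"
  shows "snake_class N (replicate m (unit_vec 1)) = snake_class N (replicate m (- unit_vec 1))"
proof -
  \<comment> \<open>\<open>?v\<close> is the last cell of the negative straight word; from there the
    positive word runs through the same segment in the other direction.\<close>
  let ?e = "unit_vec 1" and ?v = "\<lambda>j. - int m * unit_vec 1 j"
  have pos: "pos p (replicate m d) i = (\<lambda>j. p j + int i * d j)" if "i \<le> m" for p d i
    using that by (auto simp: pos_def fun_eq_iff sum_list_fun_apply sum_list_replicate min_def)
  have "pos 0 (replicate m (- ?e)) ` {..m} = pos ?v (replicate m ?e) ` {..m}"
  proof -
    have *: "pos 0 (replicate m (- ?e)) i = pos ?v (replicate m ?e) (m - i)" if "i \<le> m" for i
      using that by (auto simp: pos fun_eq_iff of_nat_diff algebra_simps)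
    have "pos 0 (replicate m (- ?e)) ` {..m} = pos ?v (replicate m ?e) ` (\<lambda>i. m - i) ` {..m}"
      unfolding image_image using * by (intro image_cong) auto
    also have "(\<lambda>i. m - i) ` {..m} = {..m}"
    proof (intro equalityI subsetI)
      fix x assume "x \<in> {..m}"
      then show "x \<in> (\<lambda>i. m - i) ` {..m}"
        by (intro image_eqI[of _ _ "m - x"]) auto
    qed auto
    finally show ?thesis .
  qed
  moreover have "?v \<in> cell_lattice N"
    using assms by (auto simp: cell_lattice_def unit_vec_def)
  ultimately show ?thesis
    using replicate_good_words[of ?e m N] replicate_good_words[of "- ?e" m N] assms
    by (subst snake_class_eq_iff) (auto simp: good_words_def)
qed

lemma unit_vec_neq_uminus: "unit_vec i \<noteq> - unit_vec i"
  by (auto simp: fun_eq_iff unit_vec_def)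

text \<open>The two straight words share a class and no other two words do, so dropping one of them
  leaves one word per class. For \<open>m = 0\<close> they are the same empty word, hence
  \<open>m > 0\<close>.\<close>

lemma pds_Suc:
  assumes "N \<ge> 2" "m > 0"
  shows "pds N (Suc m) = card (good_words N m) - 1"
proof -
  let ?a = "replicate m (unit_vec 1)" and ?b = "replicate m (- unit_vec 1)"
  have ab: "?a \<in> good_words N m" "?b \<in> good_words N m" "?a \<noteq> ?b"
    using replicate_good_words assms(2) unit_vec_neq_uminus by auto
  have "snake_class N ?b \<in> snake_class N ` (good_words N m - {?b})"
    using ab snake_class_replicate[OF assms(1), of m] by (intro image_eqI[of _ _ ?a]) auto
  then have "snake_class N ` insert ?b (good_words N m - {?b}) = snake_class N ` (good_words N m - {?b})"
    by auto
  then have "snake_class N ` good_words N m = snake_class N ` (good_words N m - {?b})"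
    unfolding insert_Diff[OF ab(2)] .
  moreover have "inj_on (snake_class N) (good_words N m - {?b})"
  proof (rule inj_onI)
    fix w w' assume w: "w \<in> good_words N m - {?b}" "w' \<in> good_words N m - {?b}"
      "snake_class N w = snake_class N w'"
    then obtain v where "pos 0 w' ` {..m} = pos v w ` {..m}"
      using snake_class_eq_iff[of w N w'] assms(1) by (auto simp: good_words_def)
    then have "w = w' \<or> (\<exists>d\<in>{unit_vec 1, - unit_vec 1}. w = replicate m d \<and> w' = replicate m (- d))"
      using w assms(1) by (intro pos_image_eqD[of _ N]) (auto simp: good_words_def)
    \<comment> \<open>In the exceptional case one of the two words is \<open>?b\<close>, which has
      been removed.\<close>
    then show "w = w'"
      using w by auto
  qed
  ultimately show ?thesis
    using ab finite_good_words unfolding pds_def quotient_pds_of_length[OF assms(1)]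
    by (simp add: card_image card_Diff_singleton)
qed

lemma good_words_0: "good_words N 0 = {[]}"
  by (auto simp: good_words_def)

lemma pds_1: "N \<ge> 2 \<Longrightarrow> pds N (Suc 0) = 1"
  unfolding pds_def quotient_pds_of_length by (simp add: good_words_0)

lemma pds_0: "pds N 0 = 1"
proof -
  have "partially_directed_snake N {}"
    by (auto simp: partially_directed_snake_def snake_def connected_cells_def cell_cycle_def)
  then have "pds_of_length N 0 = {{}}"
    by (auto simp: pds_of_length_def partially_directed_snake_def snake_def)
  then show ?thesis
    by (simp add: pds_def quotient_def)
qed

subsection \<open>Counting words\<close>

text \<open>Together with \<open>rise_horizontal_words\<close>, these are the words with an x_1-step
  among their first two letters, that is, those that force the sign of an x_1-step put in
  front.\<close>

definition horizontal_words :: "nat \<Rightarrow> nat \<Rightarrow> cell list set" where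
  "horizontal_words N m = {w \<in> good_words N m. w \<noteq> [] \<and> hd w 1 \<noteq> 0}"

definition rise_horizontal_words :: "nat \<Rightarrow> nat \<Rightarrow> cell list set" where
  "rise_horizontal_words N m =
    {w \<in> good_words N m. length w \<ge> 2 \<and> hd w 1 = 0 \<and> (w ! 1) 1 \<noteq> 0}"

lemma good_Cons_rise: "d 1 = 0 \<Longrightarrow> good (d # w) \<longleftrightarrow> good w"
  by (auto simp: good_Cons)

lemma all_less_2: "(\<forall>j<n. j < 2 \<longrightarrow> P j) \<longleftrightarrow> (n > 0 \<longrightarrow> P 0) \<and> (n > 1 \<longrightarrow> P (1::nat))"
  by (auto simp: less_2_cases_iff)

lemma card_rise_directions: "card {d \<in> pd_directions N. d 1 = 0} = N - 1"
proof -
  have "{d \<in> pd_directions N. d 1 = 0} = unit_vec ` {2..N}"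
    by (auto simp: pd_directions_def unit_vec_def)
  moreover have "inj_on unit_vec {2..N}"
    by (rule inj_onI) (metis unit_vec_def zero_neq_one)
  ultimately show ?thesis
    by (simp add: card_image)
qed

lemma inj_on_Cons: "inj_on (\<lambda>(d, w). d # w) A"
  by (auto intro: inj_onI)

lemma card_Cons_rise:
  "card ((\<lambda>(d, w). d # w) ` ({d \<in> pd_directions N. d 1 = 0} \<times> W)) = (N - 1) * card W"
  by (simp add: card_image[OF inj_on_Cons] card_cartesian_product card_rise_directions del: One_nat_def)

text \<open>Split by the first letter: a rise has x_1-component 0 and so may precede any good
  word.\<close>

lemma card_good_words_Suc:
  "card (good_words N (Suc m)) = card (horizontal_words N (Suc m)) + (N - 1) * card (good_words N m)"
proof -
  let ?R = "(\<lambda>(d, w). d # w) ` ({d \<in> pd_directions N. d 1 = 0} \<times> good_words N m)"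
  have "good_words N (Suc m) = horizontal_words N (Suc m) \<union> ?R"
  proof (intro equalityI subsetI)
    fix x assume "x \<in> good_words N (Suc m)"
    then show "x \<in> horizontal_words N (Suc m) \<union> ?R"
      by (cases x) (auto simp: good_words_def horizontal_words_def good_Cons_rise image_iff)
  qed (auto simp: good_words_def horizontal_words_def good_Cons_rise)
  moreover have "horizontal_words N (Suc m) \<inter> ?R = {}"
    by (auto simp: horizontal_words_def)
  moreover have "finite (horizontal_words N (Suc m))" "finite ?R"
    using finite_good_words by (auto simp: horizontal_words_def pd_directions_def)
  ultimately show ?thesis
    by (simp add: card_Un_disjoint card_Cons_rise del: One_nat_def)
qed

lemma card_rise_horizontal_words_Suc:
  "card (rise_horizontal_words N (Suc m)) = (N - 1) * card (horizontal_words N m)"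
proof -
  have "rise_horizontal_words N (Suc m) =
      (\<lambda>(d, w). d # w) ` ({d \<in> pd_directions N. d 1 = 0} \<times> horizontal_words N m)" (is "_ = ?R")
  proof (intro equalityI subsetI)
    fix x assume "x \<in> rise_horizontal_words N (Suc m)"
    then show "x \<in> ?R"
      by (cases x) (auto simp: good_words_def horizontal_words_def rise_horizontal_words_def
        good_Cons_rise image_iff hd_conv_nth Suc_le_eq)
  qed (auto simp: good_words_def horizontal_words_def rise_horizontal_words_def good_Cons_rise
    hd_conv_nth Suc_le_eq)
  then show ?thesis
    by (simp add: card_Cons_rise del: One_nat_def)
qed

text \<open>An x_1-step among the first two letters of \<open>w\<close> fixes the sign of the new
  head, and if both letters are x_1-steps they agree because \<open>w\<close> is good. Otherwise
  both signs are possible.\<close>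

lemma horizontal_extensions:
  assumes "w \<in> good_words N m"
  shows "card {d \<in> {unit_vec 1, - unit_vec 1}. good (d # w)} =
    (if w \<in> horizontal_words N m \<union> rise_horizontal_words N m then 1 else 2)"
proof -
  let ?E = "{d \<in> {unit_vec 1, - unit_vec 1}. good (d # w)}"
  have good: "good (d # w) \<longleftrightarrow> (length w > 0 \<longrightarrow> d 1 * (w ! 0) 1 \<noteq> -1) \<and> (length w > 1 \<longrightarrow> d 1 * (w ! 1) 1 \<noteq> -1)" for d
    using assms unfolding good_Cons all_less_2 good_words_def by auto
  have val: "(w ! i) 1 \<in> {0, 1, -1}" if "i < length w" for i
  proof -
    have "w ! i \<in> pd_directions N"
      using assms that by (auto simp: good_words_def)
    then show ?thesis by (cases rule: pd_directionsE) auto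
  qed
  have w01: "(w ! 0) 1 * (w ! 1) 1 \<noteq> -1" if "length w > 1"
    using assms that by (simp add: good_words_def good_def)
  have e: "unit_vec 1 1 = 1" "(- unit_vec 1) 1 = (-1::int)"
    by (simp_all add: unit_vec_def)
  show ?thesis
  proof (cases "w \<in> horizontal_words N m \<union> rise_horizontal_words N m")
    case False
    then have "(length w > 0 \<longrightarrow> (w ! 0) 1 = 0) \<and> (length w > 1 \<longrightarrow> (w ! 1) 1 = 0)"
      using assms by (auto simp: horizontal_words_def rise_horizontal_words_def hd_conv_nth)
    then have "?E = {unit_vec 1, - unit_vec 1}"
      unfolding good by auto
    then show ?thesis
      using False unit_vec_neq_uminus by simp
  next
    case True
    obtain s where s: "s \<in> {1, -1}" "\<And>d. d 1 \<in> {1, -1} \<Longrightarrow> good (d # w) \<longleftrightarrow> d 1 = s"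
    proof (cases "w \<in> horizontal_words N m")
      case True
      then have "length w > 0" "(w ! 0) 1 \<noteq> 0"
        by (auto simp: horizontal_words_def hd_conv_nth)
      then show ?thesis
        using val[of 0] val[of 1] w01 by (intro that[of "(w ! 0) 1"]) (auto simp: good)
    next
      case False
      with \<open>w \<in> horizontal_words N m \<union> rise_horizontal_words N m\<close>
      have "length w > 1" "(w ! 0) 1 = 0" "(w ! 1) 1 \<noteq> 0"
        by (auto simp: rise_horizontal_words_def hd_conv_nth simp flip: length_greater_0_conv)
      then show ?thesis
        using val[of 1] by (intro that[of "(w ! 1) 1"]) (auto simp: good)
    qed
    have "?E = {if s = 1 then unit_vec 1 else - unit_vec 1}"
      using s(1) s(2)[of "unit_vec 1"] s(2)[of "- unit_vec 1"] e by auto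
    then show ?thesis
      using True by simp
  qed
qed

text \<open>Removing the head of a word that starts with an x_1-step leaves a good word, counted
  once for each admissible sign. The additive form avoids subtraction on \<open>nat\<close>.\<close>

lemma card_horizontal_words_Suc:
  "card (horizontal_words N (Suc m)) + card (horizontal_words N m)
    + card (rise_horizontal_words N m) = 2 * card (good_words N m)"
proof -
  let ?G = "good_words N m" and ?H = "horizontal_words N m \<union> rise_horizontal_words N m"
  let ?E = "\<lambda>w. {d \<in> {unit_vec 1, - unit_vec 1}. good (d # w)}"
  have fin: "finite ?G" by (rule finite_good_words)
  have sub: "horizontal_words N m \<subseteq> ?G" "rise_horizontal_words N m \<subseteq> ?G"
    by (auto simp: horizontal_words_def rise_horizontal_words_def)
  have "horizontal_words N (Suc m) = (\<lambda>(w, d). d # w) ` (SIGMA w:?G. ?E w)" (is "_ = ?R")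
  proof (intro equalityI subsetI)
    fix x assume x: "x \<in> horizontal_words N (Suc m)"
    then obtain d w where dw: "x = d # w" "d \<in> pd_directions N" "d 1 \<noteq> 0" "good (d # w)" "w \<in> ?G"
      by (cases x) (auto simp: good_words_def horizontal_words_def good_Cons)
    then have "d \<in> ?E w"
      by (auto elim: pd_directionsE)
    then show "x \<in> ?R"
      using dw by (auto simp: image_iff)
  next
    fix x assume "x \<in> ?R"
    then show "x \<in> horizontal_words N (Suc m)"
      by (auto simp: good_words_def horizontal_words_def pd_directions_def unit_vec_def)
  qed
  moreover have "inj_on (\<lambda>(w, d). d # w) (SIGMA w:?G. ?E w)"
    by (auto intro: inj_onI)
  ultimately have "card (horizontal_words N (Suc m)) = (\<Sum>w\<in>?G. card (?E w))"
    using fin by (simp add: card_image card_SigmaI)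
  also have "\<dots> = (\<Sum>w\<in>?G. if w \<in> ?H then 1 else 2)"
    by (intro sum.cong refl horizontal_extensions)
  \<comment> \<open>Adding one for each word with a forced sign makes every word contribute exactly
    2.\<close>
  finally have "card (horizontal_words N (Suc m)) + (\<Sum>w\<in>?G. if w \<in> ?H then 1 else 0)
      = (\<Sum>w\<in>?G. (if w \<in> ?H then 1 else 2) + (if w \<in> ?H then 1 else 0))"
    by (simp only: sum.distrib)
  also have "\<dots> = (\<Sum>w\<in>?G. 2)"
    by (intro sum.cong) auto
  also have "(\<Sum>w\<in>?G. if w \<in> ?H then 1 else 0) = card (?G \<inter> ?H)"
    using fin by (simp only: card_eq_sum sum.inter_restrict)
  also have "?G \<inter> ?H = ?H" using sub by blast
  also have "card ?H = card (horizontal_words N m) + card (rise_horizontal_words N m)"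
    using fin sub by (intro card_Un_disjoint)
      (auto simp: horizontal_words_def rise_horizontal_words_def intro: finite_subset)
  finally show ?thesis by simp
qed

text \<open>Eliminates the auxiliary counts \<open>?h\<close> and \<open>?u\<close>. What remains
  beside \<open>N * ?g (m + 2)\<close> is \<open>k * (?g (m + 1) - ?h (m + 1))\<close>; the bracket
  counts words starting with a rise and equals \<open>k * ?g m\<close>, which gives the
  square.\<close>

lemma card_good_words_rec:
  assumes "N \<ge> 2"
  shows "card (good_words N (m + 3)) = N * card (good_words N (m + 2)) + (N - 1)^2 * card (good_words N m)"
proof -
  define k where "k = N - 1"
  let ?g = "\<lambda>m. card (good_words N m)" and ?h = "\<lambda>m. card (horizontal_words N m)"
    and ?u = "\<lambda>m. card (rise_horizontal_words N m)"
  have g: "?g (Suc i) = ?h (Suc i) + k * ?g i" and u: "?u (Suc i) = k * ?h i"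
    and h: "?h (Suc i) + ?h i + ?u i = 2 * ?g i" for i
    using card_good_words_Suc card_rise_horizontal_words_Suc card_horizontal_words_Suc
    by (simp_all add: k_def)
  have N: "N = Suc k" using assms by (simp add: k_def)
  have "?g (m + 3) = ?h (m + 3) + k * ?g (m + 2)"
    using g[of "m + 2"] by (simp add: eval_nat_numeral)
  moreover have "?h (m + 3) + ?h (m + 2) + k * ?h (m + 1) = 2 * ?g (m + 2)"
    using h[of "m + 2"] u[of "m + 1"] by (simp add: eval_nat_numeral)
  moreover have "?g (m + 2) = ?h (m + 2) + k * ?g (m + 1)"
    using g[of "m + 1"] by (simp add: eval_nat_numeral)
  moreover have "k * ?g (m + 1) = k * ?h (m + 1) + k^2 * ?g m"
    using g[of m] by (simp add: algebra_simps power2_eq_square)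
  ultimately show ?thesis
    by (simp add: N k_def[symmetric])
qed

text \<open>For length 2, all (N+1)^2 pairs of directions are good except the two opposite pairs on
  the x_1 axis.\<close>

lemma card_good_words_small:
  assumes "N \<ge> 2"
  shows "card (good_words N 0) = 1" "card (good_words N 1) = N + 1"
    "card (good_words N 2) + 1 = N^2 + 2 * N"
proof -
  have 0: "card (good_words N 0) = 1" "card (horizontal_words N 0) = 0"
    "card (rise_horizontal_words N 0) = 0"
    by (simp_all add: good_words_0 horizontal_words_def rise_horizontal_words_def)
  have 1: "card (horizontal_words N 1) = 2" "card (rise_horizontal_words N 1) = 0"
    "card (good_words N 1) = N + 1"
    using card_horizontal_words_Suc[of N 0] card_rise_horizontal_words_Suc[of N 0]
      card_good_words_Suc[of N 0] 0 assms by simp_all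
  obtain k where "N = Suc k"
    using assms by (cases N) auto
  then have "card (good_words N 2) + 1 = N^2 + 2 * N"
    using card_horizontal_words_Suc[of N 1] card_good_words_Suc[of N 1] 1
    by (simp add: numeral_2_eq_2 algebra_simps)
  with 0 1 show "card (good_words N 0) = 1" "card (good_words N 1) = N + 1"
    "card (good_words N 2) + 1 = N^2 + 2 * N" by auto
qed

section \<open>The generating function\<close>

theorem mainTheorem3:
  fixes N :: nat
  assumes "N \<ge> 2"
  shows "Abs_fps (\<lambda>n. of_nat (pds N n) :: rat) =
    ((of_nat N - 1)^2 * fps_X^5 + (of_nat N - 1) * (of_nat N - 2) * fps_X^4
      - (of_nat N - 1) * (of_nat N - 3) * fps_X^3 + (of_nat N - 1) * fps_X^2
      - of_nat N * fps_X + 1)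
    / ((1 - fps_X) * (1 - of_nat N * fps_X - (of_nat N - 1)^2 * fps_X^3))"
    (is "?P = ?num / ?den")
proof -
  define g :: "nat \<Rightarrow> rat" where "g m = of_nat (card (good_words N m))" for m
  \<comment> \<open>Over the rationals N - 1, N - 2 and N - 3 become K, K - 1 and K - 2 without
    truncation; N - 3 is really negative for N = 2.\<close>
  define K :: rat where "K = of_nat N - 1"
  have N: "of_nat N = K + 1" by (simp add: K_def)
  have K_nat: "of_nat (N - 1) = K"
    using assms by (simp add: K_def of_nat_diff)
  have g: "g 0 = 1" "g 1 = K + 2" "g 2 = (K + 1)^2 + 2 * (K + 1) - 1"
    "g (m + 3) = (K + 1) * g (m + 2) + K^2 * g m" for m
  proof -
    show "g 0 = 1" "g 1 = K + 2"
      using card_good_words_small(1,2)[OF assms] by (simp_all add: g_def N)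
    have "(of_nat (card (good_words N 2) + 1) :: rat) = of_nat (N^2 + 2 * N)"
      using card_good_words_small(3)[OF assms] by simp
    then show "g 2 = (K + 1)^2 + 2 * (K + 1) - 1"
      by (simp add: g_def N)
    show "g (m + 3) = (K + 1) * g (m + 2) + K^2 * g m"
      unfolding g_def card_good_words_rec[OF assms] by (simp add: N K_nat del: One_nat_def)
  qed
  have g_rec: "g 3 = (K + 1) * g 2 + K^2 * g 0" "g 4 = (K + 1) * g 3 + K^2 * g 1"
    "g (m + 4) = (K + 1) * g (m + 3) + K^2 * g (m + 1)"
    "g (m + 5) = (K + 1) * g (m + 4) + K^2 * g (m + 2)" for m
    using g(4)[of 0] g(4)[of 1] g(4)[of "m + 1"] g(4)[of "m + 2"] by (simp_all add: eval_nat_numeral)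
  \<comment> \<open>Nothing is subtracted for the empty snake and the single cell, so the uniform
    formula starts at n = 2.\<close>
  have P: "fps_nth ?P n = (if n \<le> 1 then 1 else g (n - 1) - 1)" for n
  proof -
    consider "n = 0" | "n = Suc 0" | m where "n = Suc (Suc m)"
      by (metis not0_implies_Suc)
    then show ?thesis
    proof cases
      case (3 m)
      have "card (good_words N (Suc m)) > 0"
        using replicate_good_words[of "unit_vec 1" "Suc m" N] finite_good_words
        by (auto simp: card_gt_0_iff)
      then show ?thesis
        using 3 pds_Suc[OF assms, of "Suc m"] by (simp add: g_def of_nat_diff)
    qed (use pds_0 pds_1[OF assms] in auto)
  qed
  have ofN: "(of_nat N :: rat fps) = fps_const (K + 1)"
    unfolding N[symmetric] by (simp add: fps_of_nat)
  have const_eqs: "(of_nat N - 1 :: rat fps) = fps_const K" "(of_nat N - 2 :: rat fps) = fps_const (K - 1)"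
    "(of_nat N - 3 :: rat fps) = fps_const (K - 2)"
    unfolding ofN by (simp_all add: fps_eq_iff numeral_fps_const)
  \<comment> \<open>The denominator is multiplied out so that each coefficient of the product is a
    combination of five consecutive coefficients of \<open>F\<close>.\<close>
  have den: "?den * F = F - fps_const (K + 2) * (fps_X * F) + fps_const (K + 1) * (fps_X^2 * F)
      - fps_const (K^2) * (fps_X^3 * F) + fps_const (K^2) * (fps_X^4 * F)" for F :: "rat fps"
  proof -
    have c: "fps_const (K + 1) = fps_const K + 1" "fps_const (K + 2) = fps_const K + 2"
      "fps_const (K^2) = (fps_const K)^2"
      by (simp_all add: fps_eq_iff numeral_fps_const fps_const_power)
    show ?thesis
      unfolding const_eqs unfolding ofN c
      by (simp add: algebra_simps power2_eq_square power3_eq_cube power4_eq_xxxx)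
  qed
  have num: "?num = fps_const (K^2) * fps_X^5 + fps_const (K * (K - 1)) * fps_X^4
      - fps_const (K * (K - 2)) * fps_X^3 + fps_const K * fps_X^2 - fps_const (K + 1) * fps_X + 1"
    unfolding const_eqs unfolding ofN by (simp add: fps_const_power)
  have "?den * F = ?num" if F_eq: "F = ?P" for F
    unfolding den num
  proof (rule fps_ext)
    fix n :: nat
    have F: "fps_nth F n = (if n \<le> 1 then 1 else g (n - 1) - 1)" for n
      unfolding F_eq by (rule P)
    have "fps_nth (F - fps_const (K + 2) * (fps_X * F) + fps_const (K + 1) * (fps_X^2 * F)
        - fps_const (K^2) * (fps_X^3 * F) + fps_const (K^2) * (fps_X^4 * F)) n =
      fps_nth F n - (K + 2) * (if n < 1 then 0 else fps_nth F (n - 1))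
      + (K + 1) * (if n < 2 then 0 else fps_nth F (n - 2))
      - K^2 * (if n < 3 then 0 else fps_nth F (n - 3))
      + K^2 * (if n < 4 then 0 else fps_nth F (n - 4))"
      by (simp add: fps_X_power_mult_nth)
    also have "\<dots> = (if n = 5 then K^2 else 0) + (if n = 4 then K * (K - 1) else 0)
      - (if n = 3 then K * (K - 2) else 0) + (if n = 2 then K else 0)
      - (if n = 1 then K + 1 else 0) + (if n = 0 then 1 else 0)"
    proof -
      \<comment> \<open>The product reaches back to index n - 4, and the formula for the
        coefficients of \<open>F\<close> is uniform from index 2 on. Thus n \<ge> 6 is the generic
        case, and the others yield the numerator of degree 5.\<close>
      consider "n = 0" | "n = 1" | "n = 2" | "n = 3" | "n = 4" | "n = 5" | m where "n = m + 6"
        using that(7)[of "n - 6"] by linarith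
      then show ?thesis
      proof cases
        case (7 m)
        then have "fps_nth F n = g (m + 5) - 1" "fps_nth F (n - 1) = g (m + 4) - 1"
          "fps_nth F (n - 2) = g (m + 3) - 1" "fps_nth F (n - 3) = g (m + 2) - 1"
          "fps_nth F (n - 4) = g (m + 1) - 1" "n \<ge> 6"
          by (simp_all add: F add.commute)
        \<comment> \<open>The combination is the difference of two consecutive instances of the
          recurrence for \<open>g\<close>. The constants -1 cancel since the expanded denominator
          vanishes at q = 1.\<close>
        then show ?thesis
          by simp (simp add: g_rec(3,4)[of m] algebra_simps)
      qed (use g(1-3) g_rec(1,2) in \<open>simp_all add: F algebra_simps power2_eq_square\<close>)
    qed
    also have "\<dots> = fps_nth (fps_const (K^2) * fps_X^5 + fps_const (K * (K - 1)) * fps_X^4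
      - fps_const (K * (K - 2)) * fps_X^3 + fps_const K * fps_X^2 - fps_const (K + 1) * fps_X + 1) n"
      by (simp add: fps_X_power_nth)
    finally show "fps_nth (F - fps_const (K + 2) * (fps_X * F) + fps_const (K + 1) * (fps_X^2 * F)
        - fps_const (K^2) * (fps_X^3 * F) + fps_const (K^2) * (fps_X^4 * F)) n = \<dots>" .
  qed
  then have "?den * ?P = ?num" by blast
  \<comment> \<open>The constant coefficient is 1, so \<open>?den\<close> is nonzero and may be
    cancelled.\<close>
  moreover have "?den \<noteq> 0"
  proof
    assume "?den = 0"
    then have "fps_nth ?den 0 = 0" by simp
    then show False by simp
  qed
  ultimately show ?thesis
    by (metis nonzero_mult_div_cancel_left)
qed

end
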